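(* Let $p>1$, $\frac1p+\frac1q=1$, $\alpha>0$, $\beta\in(0,1]$, $x>1$, let $f,g$ be two positive integrable functions on $[1,\infty)$, and let $m,M$ be real constants such that $0<m<\frac{f(\tau)}{g(\tau)}<M$ for all $\tau\in(1,x)$. Then $$\mathcal{H}^{\alpha,\beta}_{1,x}[f(x)g(x)]\le\frac{2^{p-1}M^{p}}{p(M+1)^{p}}\,\mathcal{H}^{\alpha,\beta}_{1,x}[f^{p}(x)+g^{p}(x)]+\frac{2^{q-1}}{q(m+1)^{q}}\,\mathcal{H}^{\alpha,\beta}_{1,x}[f^{q}(x)+g^{q}(x)].$$
   Context: For $\alpha>0$, $\beta\in(0,1]$ and $x>1$, the one-sided generalized proportional Hadamard fractional integral of a (measurable) function $z$ on $[1,\infty)$ is $$\mathcal{H}^{\alpha,\beta}_{1,x}[z(x)]=(\mathcal{H}^{\alpha,\beta}_{1,x}z)(x)=\frac{1}{\beta^{\alpha}\Gamma(\alpha)}\int_{1}^{x}e^{\frac{\beta-1}{\beta}(\ln x-\ln t)}(\ln x-\ln t)^{\alpha-1}\frac{z(t)}{t}\,dt,$$ where $\Gamma$ is the gamma function. For nonnegative $z$ the integral is a Lebesgue integral with value in $[0,\infty]$. Here $f^r(x)$ means $(f(x))^r$. *)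

theory Defs
  imports "HOL-Analysis.Analysis"
begin

text \<open>The one-sided generalized proportional Hadamard fractional integral with lower
  terminal 1, for nonnegative \<open>z\<close>: a Lebesgue integral with value in \<open>[0, \<infinity>]\<close>. It is not
  meant for \<open>z\<close> of varying sign, since \<^const>\<open>ennreal\<close> truncates negative values to 0.
  At the end point \<open>t = x\<close> the convention \<open>0 powr a = 0\<close> applies, on a null set.\<close>

definition hadamard_integral :: "real \<Rightarrow> real \<Rightarrow> (real \<Rightarrow> real) \<Rightarrow> real \<Rightarrow> ennreal" where
  "hadamard_integral \<alpha> \<beta> z x =
     ennreal (1 / (\<beta> powr \<alpha> * Gamma \<alpha>)) *
     (\<integral>\<^sup>+t\<in>{1..x}. ennreal (exp ((\<beta> - 1) / \<beta> * (ln x - ln t)) *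
        (ln x - ln t) powr (\<alpha> - 1) * (z t / t)) \<partial>lebesgue)"

end

theory Submission
  imports Defs
begin

text \<open>
  The inequality is a pointwise one, integrated against the nonnegative kernel of the
  fractional integral. On \<open>(1, x)\<close> the two bounds on the quotient \<open>f / g\<close> say that
  \<open>f \<le> M / (M + 1) * (f + g)\<close> and \<open>g \<le> 1 / (m + 1) * (f + g)\<close>. Young's inequality bounds
  \<open>f * g\<close> by \<open>f\<^sup>p / p + g\<^sup>q / q\<close>; the two bounds replace the separate powers by powers of
  \<open>f + g\<close>, and by convexity of \<open>y \<mapsto> y\<^sup>r\<close> the power \<open>(f + g)\<^sup>r\<close> is at most
  \<open>2\<^bsup>r - 1\<^esup> * (f\<^sup>r + g\<^sup>r)\<close>. The
  constants of the theorem are exactly the products that arise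
  (\<open>mult_le_sum_powr_of_ratio_bounds\<close>).

  What remains is that the fractional integral is monotone (\<open>hadamard_integral_mono\<close>) and
  linear on nonnegative measurable functions (\<open>hadamard_integral_linear\<close>). The bounds on the
  quotient are given only inside the interval, so monotonicity has to disregard the two end
  points. The integrals of the powers may be infinite, so both facts are about integrals with
  values in \<open>[0, \<infinity>]\<close>, and linearity rests on the measurability of \<open>f\<close> and \<open>g\<close>.
\<close>

section \<open>The pointwise inequality\<close>

text \<open>Convexity of \<open>y \<mapsto> y\<^sup>r\<close> at the midpoint of \<open>a\<close> and \<open>b\<close>, multiplied by \<open>2\<^sup>r\<close>.\<close>

lemma powr_add_le:
  fixes a b r :: real
  assumes "r \<ge> 1" "a > 0" "b > 0"
  shows "(a + b) powr r \<le> 2 powr (r - 1) * (a powr r + b powr r)"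
proof -
  have "((a + b) / 2) powr r \<le> (a powr r + b powr r) / 2"
    using convex_onD[OF powr_convex[OF assms(1)], of "1/2" a b] assms
    by (simp add: add_divide_distrib)
  then have "(a + b) powr r / 2 powr r \<le> (a powr r + b powr r) / 2"
    using assms by (simp add: powr_divide)
  then show ?thesis
    by (simp add: powr_diff field_simps)
qed

text \<open>This is where the shape of the two coefficients comes from: a bound of \<open>a\<close> by a fixed
  proportion \<open>c\<close> of \<open>a + b\<close> becomes the factor \<open>c\<^sup>r\<close>.\<close>

lemma powr_le_of_le_proportion:
  fixes a b c r y :: real
  assumes "r \<ge> 1" "a > 0" "b > 0" "c \<ge> 0" "0 \<le> y" "y \<le> c * (a + b)"
  shows "y powr r \<le> c powr r * (2 powr (r - 1) * (a powr r + b powr r))"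
proof -
  have "y powr r \<le> (c * (a + b)) powr r"
    using assms by (intro powr_mono2) auto
  also have "\<dots> = c powr r * (a + b) powr r"
    using assms by (simp add: powr_mult)
  also have "\<dots> \<le> c powr r * (2 powr (r - 1) * (a powr r + b powr r))"
    using powr_add_le[OF assms(1-3)] by (intro mult_left_mono) auto
  finally show ?thesis .
qed

lemma mult_le_sum_powr_of_ratio_bounds:
  fixes a b p q m M :: real
  assumes pq: "p > 1" "q > 1" "1 / p + 1 / q = 1"
    and pos: "a > 0" "b > 0" "m > 0"
    and ratio: "m \<le> a / b" "a / b \<le> M"
  shows "a * b \<le> 2 powr (p - 1) * M powr p / (p * (M + 1) powr p) * (a powr p + b powr p)
               + 2 powr (q - 1) / (q * (m + 1) powr q) * (a powr q + b powr q)"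
proof -
  have M: "M > 0"
    using ratio pos by linarith
  have "a \<le> M / (M + 1) * (a + b)" "b \<le> 1 / (m + 1) * (a + b)"
    using ratio pos M by (simp_all add: field_simps)
  then have "a powr p \<le> (M / (M + 1)) powr p * (2 powr (p - 1) * (a powr p + b powr p))"
    and "b powr q \<le> (1 / (m + 1)) powr q * (2 powr (q - 1) * (a powr q + b powr q))"
    using pq pos M by (auto intro!: powr_le_of_le_proportion)
  then have "a powr p / p \<le> (M / (M + 1)) powr p * (2 powr (p - 1) * (a powr p + b powr p)) / p"
    and "b powr q / q \<le> (1 / (m + 1)) powr q * (2 powr (q - 1) * (a powr q + b powr q)) / q"
    using pq by (auto intro!: divide_right_mono)
  moreover have "a * b \<le> a powr p / p + b powr q / q"
    using Youngs_inequality[OF pq] pos by simp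
  ultimately show ?thesis
    using M pos by (simp add: powr_divide mult_ac)
qed

section \<open>Monotonicity and linearity of the fractional integral\<close>

text \<open>The kernel is nonnegative, and the end points form a null set.\<close>

lemma hadamard_integral_mono:
  assumes "\<And>t. t \<in> {1<..<x} \<Longrightarrow> u t \<le> v t"
  shows "hadamard_integral \<alpha> \<beta> u x \<le> hadamard_integral \<alpha> \<beta> v x"
proof -
  have "AE t in lebesgue. t \<noteq> (1::real)" "AE t in lebesgue. t \<noteq> x"
    by (intro AE_completion AE_lborel_singleton)+
  then show ?thesis
    unfolding hadamard_integral_def
    by (intro mult_left_mono nn_integral_mono_AE)
       (auto elim!: eventually_elim2 split: split_indicator
             intro!: assms ennreal_leI mult_left_mono divide_right_mono)
qed

lemma hadamard_integral_linear:
  assumes meas: "set_borel_measurable lebesgue {1..x} u" "set_borel_measurable lebesgue {1..x} v"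
    and nonneg: "\<And>t. t \<in> {1..x} \<Longrightarrow> 0 \<le> u t" "\<And>t. t \<in> {1..x} \<Longrightarrow> 0 \<le> v t" "0 \<le> c" "0 \<le> d"
  shows "hadamard_integral \<alpha> \<beta> (\<lambda>t. c * u t + d * v t) x =
    ennreal c * hadamard_integral \<alpha> \<beta> u x + ennreal d * hadamard_integral \<alpha> \<beta> v x"
proof -
  define K :: "real \<Rightarrow> real" where
    "K t = exp ((\<beta> - 1) / \<beta> * (ln x - ln t)) * (ln x - ln t) powr (\<alpha> - 1) / t" for t
  \<comment> \<open>The integrand written with the restriction of \<open>z\<close> to \<open>[1, x]\<close>: outside this interval
    nothing is known about \<open>z\<close>, not even measurability.\<close>
  define I where "I z t = ennreal (K t * (indicator {1..x} t *\<^sub>R z t))" for z :: "real \<Rightarrow> real" and t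
  have H: "hadamard_integral \<alpha> \<beta> z x =
      ennreal (1 / (\<beta> powr \<alpha> * Gamma \<alpha>)) * (\<integral>\<^sup>+t. I z t \<partial>lebesgue)" for z
    unfolding hadamard_integral_def I_def K_def
    by (intro arg_cong[where f = "(*) _"] nn_integral_cong) (auto split: split_indicator)
  have "K \<in> borel_measurable lborel"
    unfolding K_def by measurable
  then have [measurable]: "K \<in> borel_measurable lebesgue"
    by (rule measurable_completion)
  have [measurable]: "I u \<in> borel_measurable lebesgue" "I v \<in> borel_measurable lebesgue"
    using meas unfolding I_def set_borel_measurable_def by measurable
  have "I (\<lambda>t. c * u t + d * v t) t = ennreal c * I u t + ennreal d * I v t" for t
  proof (cases "t \<in> {1..x}")
    case True
    then have "0 \<le> K t"
      by (simp add: K_def)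
    then show ?thesis
      using True nonneg
      by (simp add: I_def ennreal_mult[symmetric] ennreal_plus[symmetric] algebra_simps
               del: ennreal_plus)
  qed (simp add: I_def)
  then have "(\<integral>\<^sup>+t. I (\<lambda>t. c * u t + d * v t) t \<partial>lebesgue) =
      ennreal c * (\<integral>\<^sup>+t. I u t \<partial>lebesgue) + ennreal d * (\<integral>\<^sup>+t. I v t \<partial>lebesgue)"
    by (simp add: nn_integral_add nn_integral_cmult)
  then show ?thesis
    by (simp add: H distrib_left mult_ac)
qed

lemma set_borel_measurable_powr_add:
  fixes f g :: "'a \<Rightarrow> real"
  assumes "set_borel_measurable N A f" "set_borel_measurable N A g"
  shows "set_borel_measurable N A (\<lambda>t. f t powr r + g t powr r)"
proof -
  have "(\<lambda>t. (indicator A t *\<^sub>R f t) powr r + (indicator A t *\<^sub>R g t) powr r) \<in> borel_measurable N"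
    using assms unfolding set_borel_measurable_def by measurable
  \<comment> \<open>Off \<open>A\<close> both sides vanish, since \<open>0 powr r = 0\<close>.\<close>
  moreover have "(\<lambda>t. (indicator A t *\<^sub>R f t) powr r + (indicator A t *\<^sub>R g t) powr r) =
      (\<lambda>t. indicator A t *\<^sub>R (f t powr r + g t powr r))"
    by (auto split: split_indicator)
  ultimately show ?thesis
    unfolding set_borel_measurable_def by simp
qed

section \<open>The inequality for the fractional integral\<close>

theorem theorem4p3:
  fixes p q \<alpha> \<beta> x m M :: real and f g :: "real \<Rightarrow> real"
  assumes "p > 1" and "1 / p + 1 / q = 1"
    and "\<alpha> > 0" and "\<beta> \<in> {0<..1}" and "x > 1"
    and "set_integrable lebesgue {1..} f" and "set_integrable lebesgue {1..} g"
    and "\<And>t. t \<ge> 1 \<Longrightarrow> f t > 0" and "\<And>t. t \<ge> 1 \<Longrightarrow> g t > 0"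
    and "0 < m"
    and "\<And>\<tau>. \<tau> \<in> {1<..<x} \<Longrightarrow> m < f \<tau> / g \<tau> \<and> f \<tau> / g \<tau> < M"
  shows "hadamard_integral \<alpha> \<beta> (\<lambda>t. f t * g t) x \<le>
      ennreal (2 powr (p - 1) * M powr p / (p * (M + 1) powr p)) *
        hadamard_integral \<alpha> \<beta> (\<lambda>t. f t powr p + g t powr p) x +
      ennreal (2 powr (q - 1) / (q * (m + 1) powr q)) *
        hadamard_integral \<alpha> \<beta> (\<lambda>t. f t powr q + g t powr q) x"
proof -
  let ?C = "2 powr (p - 1) * M powr p / (p * (M + 1) powr p)"
  let ?D = "2 powr (q - 1) / (q * (m + 1) powr q)"
  have "0 < 1 / p" "1 / p < 1"
    using assms(1) by auto
  then have "0 < 1 / q" "1 / q < 1"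
    using assms(2) by linarith+
  then have q: "q > 1"
    by auto
  have "set_borel_measurable lebesgue {1..} f" "set_borel_measurable lebesgue {1..} g"
    using assms(6,7) unfolding set_integrable_def set_borel_measurable_def
    by (auto intro: borel_measurable_integrable)
  then have meas: "set_borel_measurable lebesgue {1..x} f" "set_borel_measurable lebesgue {1..x} g"
    by (auto intro: set_borel_measurable_subset)
  have "hadamard_integral \<alpha> \<beta> (\<lambda>t. f t * g t) x \<le>
      hadamard_integral \<alpha> \<beta>
        (\<lambda>t. ?C * (f t powr p + g t powr p) + ?D * (f t powr q + g t powr q)) x"
  proof (rule hadamard_integral_mono)
    fix t assume t: "t \<in> {1<..<x}"
    show "f t * g t \<le> ?C * (f t powr p + g t powr p) + ?D * (f t powr q + g t powr q)"
      using t assms(8,9)[of t] assms(11)[OF t]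
      by (intro mult_le_sum_powr_of_ratio_bounds assms(1,2,10) q) auto
  qed
  also have "\<dots> = ennreal ?C * hadamard_integral \<alpha> \<beta> (\<lambda>t. f t powr p + g t powr p) x +
      ennreal ?D * hadamard_integral \<alpha> \<beta> (\<lambda>t. f t powr q + g t powr q) x"
    using assms(1) q by (intro hadamard_integral_linear set_borel_measurable_powr_add meas) auto
  finally show ?thesis .
qed

end
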